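(* Let $\mathcal F$ be a finite reduced collection of forbidden words over $\Sigma$ such that $\Sigma_{\mathcal F}$ is irreducible, let $\mathcal R=\{r_1(m_1),\dots,r_\ell(m_\ell)\}$ be a reduced collection of repeated words for $\mathcal F$, and let $p\ge 2$ be the length of the longest word in $\mathcal F\cup\mathcal R$. Then the generalized language $\Lambda^p=\bigcup_{n\ge p}\Lambda_n$ is the language of an edge shift if and only if all the words in $\mathcal R$ have length $p$.
   Context: Let $\Sigma$ be a finite symbol set. A word is a finite sequence over $\Sigma$; $|w|$ is the length of $w$. A finite collection of words is reduced if for any two distinct words in it neither is a (contiguous) subword of the other. $\mathcal F$ is a finite reduced collection of words of length at least $2$; $\Sigma_{\mathcal F}\subseteq\Sigma^{\mathbb N}$ is the set of one-sided sequences containing no word of $\mathcal F$ as a subword. A word is allowed if it is a subword of some sequence in $\Sigma_{\mathcal F}$; $\mathcal L_n$ ($n\ge1$) is the set of allowed words of length $n$. It is assumed that every symbol of $\Sigma$ is allowed and that $\Sigma_{\mathcal F}$ is irreducible: for all allowed words $u,v$ there is a word $w$ with $uwv$ allowed. A collection of repeated words is a finite reduced collection $\mathcal R=\{r_1,\dots,r_\ell\}$ of allowed words, each $r_i$ being assigned an integer multiplicity $m_i\ge 2$; this is written $\mathcal R=\{r_1(m_1),\dots,r_\ell(m_\ell)\}$. For $w\in\mathcal L_n$ the multiplicity is $m(w)=\prod_{i=1}^{\ell}m_i^{n(w;r_i)}$, where $n(w;r_i)$ is the number of occurrences of $r_i$ as a subword of $w$; $m(w)=0$ if $w$ is not allowed.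 $\Lambda_n$ is the multiset in which each $w\in\mathcal L_n$ appears $m(w)$ times. For words $X=x_1\dots x_k$, $Y=y_1\dots y_k$ with $k\ge2$, $X*Y$ is defined only if $x_2\dots x_k=y_1\dots y_{k-1}$, and then $X*Y=x_1\dots x_ky_k$; if $k=1$, $X*Y=x_1y_1$. For a non-negative integer matrix $A$ indexed by $\mathcal L_{p-1}$, $\mathcal G_A$ is the directed multigraph with vertex set $\mathcal L_{p-1}$ and $A_{XY}$ distinct edges from $X$ to $Y$; the edge shift $\Sigma_A$ is the set of all one-sided infinite paths of edges in $\mathcal G_A$. The statement "$\Lambda^p$ is the language of an edge shift" means: there is a non-negative integer matrix $A$ indexed by $\mathcal L_{p-1}$, with $A_{XY}=0$ unless $X*Y$ is defined and belongs to $\mathcal L_p$, such that for every $n\ge p$ and every $w=x_1\dots x_n\in\mathcal L_n$, $m(w)$ equals the number of paths of edges in $\mathcal G_A$ with vertices $X_1,\dots,X_{n-p+2}$ (in this order), where $X_i=x_ix_{i+1}\dots x_{i+p-2}$; that is, $m(w)=\prod_{i=1}^{n-p+1}A_{X_iX_{i+1}}$. *)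

theory Defs
  imports
    "HOL-Library.Sublist"
    "HOL-Library.Multiset"
    "Graph_Theory.Arc_Walk"
begin

text \<open>The symbol set is a type of class \<^class>\<open>finite\<close>, words are lists, and one-sided sequences
  are functions on \<^typ>\<open>nat\<close>. ``Subword'' is the contiguous \<^const>\<open>sublist\<close>.\<close>

definition reduced :: "'a list set \<Rightarrow> bool" where
  "reduced C \<longleftrightarrow> (\<forall>u\<in>C. \<forall>v\<in>C. u \<noteq> v \<longrightarrow> \<not> sublist u v)"

definition occurs_in_seq :: "'a list \<Rightarrow> (nat \<Rightarrow> 'a) \<Rightarrow> bool" where
  "occurs_in_seq w x \<longleftrightarrow> (\<exists>i. w = map x [i..<i + length w])"

definition shift_space :: "'a list set \<Rightarrow> (nat \<Rightarrow> 'a) set" where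
  "shift_space F = {x. \<forall>f\<in>F. \<not> occurs_in_seq f x}"

definition allowed :: "'a list set \<Rightarrow> 'a list \<Rightarrow> bool" where
  "allowed F w \<longleftrightarrow> (\<exists>x\<in>shift_space F. occurs_in_seq w x)"

definition allowed_words :: "'a list set \<Rightarrow> nat \<Rightarrow> 'a list set" where
  "allowed_words F n = {w. allowed F w \<and> length w = n}"

definition irreducible_shift :: "'a list set \<Rightarrow> bool" where
  "irreducible_shift F \<longleftrightarrow>
     (\<forall>u v. allowed F u \<and> allowed F v \<longrightarrow> (\<exists>w. allowed F (u @ w @ v)))"

definition forbidden_collection :: "'a list set \<Rightarrow> bool" where
  "forbidden_collection F \<longleftrightarrow> finite F \<and> reduced F \<and> (\<forall>f\<in>F. 2 \<le> length f)"

text \<open>The collection \<open>{r\<^sub>1(m\<^sub>1), \<dots>, r\<^sub>l(m\<^sub>l)}\<close> is given by the set \<open>R\<close> of its words and a function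
  \<open>m\<close> carrying the multiplicities; values of \<open>m\<close> outside \<open>R\<close> are irrelevant.\<close>

definition repeated_collection :: "'a list set \<Rightarrow> 'a list set \<Rightarrow> ('a list \<Rightarrow> nat) \<Rightarrow> bool" where
  "repeated_collection F R m \<longleftrightarrow>
     finite R \<and> reduced R \<and> (\<forall>r\<in>R. allowed F r \<and> 2 \<le> m r)"

definition occurrences :: "'a list \<Rightarrow> 'a list \<Rightarrow> nat" where
  "occurrences w r =
     card {i. i + length r \<le> length w \<and> take (length r) (drop i w) = r}"

definition word_mult :: "'a list set \<Rightarrow> 'a list set \<Rightarrow> ('a list \<Rightarrow> nat) \<Rightarrow> 'a list \<Rightarrow> nat" where
  "word_mult F R m w = (if allowed F w then \<Prod>r\<in>R. m r ^ occurrences w r else 0)"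

definition Lambda ::
    "('a::finite) list set \<Rightarrow> 'a list set \<Rightarrow> ('a list \<Rightarrow> nat) \<Rightarrow> nat \<Rightarrow> 'a list multiset" where
  "Lambda F R m n = (\<Sum>w\<in>allowed_words F n. replicate_mset (word_mult F R m w) w)"

text \<open>The partial product \<open>X * Y\<close>. For words of length 1 the overlap condition reads
  \<open>[] = []\<close>, so it always holds and the result is \<open>x\<^sub>1 y\<^sub>1\<close>, as it should be.\<close>

definition star :: "'a list \<Rightarrow> 'a list \<Rightarrow> 'a list option" where
  "star X Y =
     (if length X = length Y \<and> X \<noteq> [] \<and> tl X = butlast Y then Some (X @ [last Y]) else None)"

text \<open>The \<open>A X Y\<close> distinct edges from \<open>X\<close> to \<open>Y\<close> are the triples \<open>(X, Y, k)\<close> with \<open>k < A X Y\<close>.\<close>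

definition matrix_graph ::
    "'v set \<Rightarrow> ('v \<Rightarrow> 'v \<Rightarrow> nat) \<Rightarrow> ('v, 'v \<times> 'v \<times> nat) pre_digraph" where
  "matrix_graph V A =
     \<lparr>verts = V, arcs = {(X, Y, k). X \<in> V \<and> Y \<in> V \<and> k < A X Y},
      tail = fst, head = fst \<circ> snd\<rparr>"

definition paths_along :: "('v, 'e) pre_digraph \<Rightarrow> 'v list \<Rightarrow> 'e list set" where
  "paths_along G Xs =
     {es. pre_digraph.awalk G (hd Xs) es (last Xs) \<and> pre_digraph.awalk_verts G (hd Xs) es = Xs}"

text \<open>For \<open>w\<close> of length \<open>n \<ge> p\<close>, the \<open>n - p + 2\<close> consecutive subwords of length \<open>p - 1\<close>.\<close>

definition blocks :: "nat \<Rightarrow> 'a list \<Rightarrow> 'a list list" where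
  "blocks p w = map (\<lambda>i. take (p - 1) (drop i w)) [0..<length w - p + 2]"

text \<open>\<open>L n\<close>, for \<open>n \<ge> p\<close>, are the levels of a generalized language over the allowed words of \<open>F\<close>.\<close>

definition edge_shift_language :: "'a list set \<Rightarrow> nat \<Rightarrow> (nat \<Rightarrow> 'a list multiset) \<Rightarrow> bool" where
  "edge_shift_language F p L \<longleftrightarrow>
     (\<exists>A :: 'a list \<Rightarrow> 'a list \<Rightarrow> nat.
        (\<forall>X\<in>allowed_words F (p - 1). \<forall>Y\<in>allowed_words F (p - 1).
           \<not> (\<exists>Z. star X Y = Some Z \<and> Z \<in> allowed_words F p) \<longrightarrow> A X Y = 0) \<and>
        (\<forall>n\<ge>p. \<forall>w\<in>allowed_words F n.
           count (L n) w =
             card (paths_along (matrix_graph (allowed_words F (p - 1)) A) (blocks p w))))"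

lemma finite_allowed_words: "finite (allowed_words (F :: 'a::finite list set) n)"
proof (rule finite_subset)
  show "allowed_words F n \<subseteq> {w. set w \<subseteq> UNIV \<and> length w = n}"
    by (auto simp: allowed_words_def)
  show "finite {w :: 'a list. set w \<subseteq> UNIV \<and> length w = n}"
    by (rule finite_lists_length_eq) simp
qed

lemma count_Lambda:
  assumes "w \<in> allowed_words F n"
  shows "count (Lambda F R m n) w = word_mult F R m w"
  using assms finite_allowed_words[of F n]
  by (simp add: Lambda_def count_sum)

lemma card_paths_along_matrix_graph:
  assumes "set (X # Xs) \<subseteq> V"
  shows "card (paths_along (matrix_graph V A) (X # Xs)) =
           (\<Prod>i<length Xs. A ((X # Xs) ! i) ((X # Xs) ! Suc i))"
  using assms
proof (induction Xs arbitrary: X)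
  case Nil
  let ?G = "matrix_graph V A"
  have "pre_digraph.awalk_verts ?G X es = [X] \<longleftrightarrow> es = []" for es
    by (cases es) (simp_all add: pre_digraph.awalk_verts.simps pre_digraph.awalk_verts_non_Nil)
  moreover have "pre_digraph.awalk ?G X [] X"
    using Nil by (simp add: pre_digraph.awalk_def pre_digraph.cas.simps matrix_graph_def)
  ultimately have "paths_along ?G [X] = {[]}"
    by (auto simp: paths_along_def)
  then show ?case by simp
next
  case (Cons Y Xs)
  let ?G = "matrix_graph V A"
  let ?f = "\<lambda>(k, es). (X, Y, k) # es"
  have hd: "Z = Y" if "pre_digraph.awalk_verts ?G Z es = Y # Xs"
      "pre_digraph.cas ?G Z es W" for Z es W
    using that
    by (cases es) (simp_all add: pre_digraph.awalk_verts.simps pre_digraph.cas.simps)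
  have XY: "X \<in> V" "Y \<in> V" using Cons.prems by auto
  have mem: "e # es \<in> paths_along ?G (X # Y # Xs) \<longleftrightarrow>
      (\<exists>k<A X Y. e = (X, Y, k)) \<and> es \<in> paths_along ?G (Y # Xs)" (is "?l \<longleftrightarrow> ?r") for e es
  proof
    assume ?l
    then have *: "pre_digraph.awalk_verts ?G (fst (snd e)) es = Y # Xs"
        "pre_digraph.cas ?G (fst (snd e)) es (last (Y # Xs))"
        "e \<in> arcs ?G" "set es \<subseteq> arcs ?G" "fst e = X"
      by (simp_all add: paths_along_def pre_digraph.awalk_def pre_digraph.awalk_verts.simps
          pre_digraph.cas.simps matrix_graph_def)
    from hd[OF *(1,2)] have h: "fst (snd e) = Y" .
    have "\<exists>k<A X Y. e = (X, Y, k)"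
      using *(3,5) h by (cases e) (simp add: matrix_graph_def)
    moreover have "es \<in> paths_along ?G (Y # Xs)"
      using *(1,2,4) XY unfolding h
      by (simp add: paths_along_def pre_digraph.awalk_def matrix_graph_def)
    ultimately show ?r ..
  next
    assume ?r
    then show ?l
      using XY
      by (auto simp add: paths_along_def pre_digraph.awalk_def pre_digraph.awalk_verts.simps
          pre_digraph.cas.simps matrix_graph_def)
  qed
  have "[] \<notin> paths_along ?G (X # Y # Xs)"
    by (simp add: paths_along_def pre_digraph.awalk_verts.simps)
  then have "es \<in> paths_along ?G (X # Y # Xs) \<longleftrightarrow>
      es \<in> ?f ` ({..<A X Y} \<times> paths_along ?G (Y # Xs))" for es
    by (cases es) (auto simp: mem image_iff)
  then have "paths_along ?G (X # Y # Xs) = ?f ` ({..<A X Y} \<times> paths_along ?G (Y # Xs))"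
    by blast
  moreover have "inj_on ?f ({..<A X Y} \<times> paths_along ?G (Y # Xs))"
    by (auto simp: inj_on_def)
  ultimately have "card (paths_along ?G (X # Y # Xs)) = A X Y * card (paths_along ?G (Y # Xs))"
    by (simp only: card_image card_cartesian_product card_lessThan)
  also have "card (paths_along ?G (Y # Xs)) =
      (\<Prod>i<length Xs. A ((Y # Xs) ! i) ((Y # Xs) ! Suc i))"
    using Cons.IH[of Y] Cons.prems by simp
  also have "A X Y * \<dots> =
      (\<Prod>i<length (Y # Xs). A ((X # Y # Xs) ! i) ((X # Y # Xs) ! Suc i))"
    unfolding length_Cons prod.lessThan_Suc_shift by simp
  finally show ?case .
qed

end

theory Submission
  imports Defs
begin

text \<open>If all repeated words have length \<open>p\<close>, the matrix with entry \<open>m(X * Y)\<close> (read as \<open>1\<close> when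
  \<open>X * Y \<notin> R\<close>) works, because every occurrence of a repeated word is exactly one window of length
  \<open>p\<close>, i.e. one edge of the path. Conversely, let \<open>aub\<close> be allowed with \<open>|u| = p - 1\<close>. Counting
  occurrences of words of length at most \<open>p\<close> gives \<open>m(aub) m(u) = m(au) m(ub)\<close>, while an edge
  shift forces \<open>m(aub) = m(au) m(ub)\<close>; hence \<open>m(u) = 1\<close>. By irreducibility, a repeated word of
  length less than \<open>p\<close> is contained in such a \<open>u\<close>, for which \<open>m(u) \<ge> 2\<close>.\<close>

lemma finite_occurrence_positions:
  "finite {i. i + length r \<le> length w \<and> take (length r) (drop i w) = r}"
  by (rule finite_subset[of _ "{..length w}"]) auto

lemma occurrences_eq_0: "length w < length r \<Longrightarrow> occurrences w r = 0"
  by (auto simp: occurrences_def)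

text \<open>Every occurrence is either at position 0, where \<open>r\<close> is a prefix, or the
  \<open>Suc\<close>-shift of an occurrence in \<open>w\<close>.\<close>

lemma occurrences_Cons:
  "occurrences (a # w) r = (if prefix r (a # w) then 1 else 0) + occurrences w r"
proof -
  let ?P = "\<lambda>w. {i. i + length r \<le> length w \<and> take (length r) (drop i w) = r}"
  have 0: "0 \<in> ?P (a # w) \<longleftrightarrow> prefix r (a # w)"
    using prefix_length_le[of r "a # w"] take_is_prefix[of "length r" "a # w"]
    by (auto simp: prefix_def)
  have "?P (a # w) = (if prefix r (a # w) then {0} else {}) \<union> Suc ` ?P w"
  proof (rule set_eqI)
    fix i show "i \<in> ?P (a # w) \<longleftrightarrow> i \<in> (if prefix r (a # w) then {0} else {}) \<union> Suc ` ?P w"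
      using 0 by (cases i) auto
  qed
  moreover have "card ((if prefix r (a # w) then {0} else {}) \<union> Suc ` ?P w)
      = card (if prefix r (a # w) then {0::nat} else {}) + card (Suc ` ?P w)"
    by (rule card_Un_disjoint) (auto simp: finite_occurrence_positions)
  ultimately show ?thesis
    by (simp add: occurrences_def card_image)
qed

lemma occurrences_take_pos:
  assumes "length r \<le> k" "k \<le> length w" "take (length r) w = r"
  shows "occurrences (take k w) r > 0"
  using assms finite_occurrence_positions[of r "take k w"]
  by (auto simp: occurrences_def card_gt_0_iff intro!: exI[of _ 0])

text \<open>An occurrence this short cannot use both \<open>a\<close> and \<open>b\<close>, so it
  lies in \<open>au\<close> or in \<open>ub\<close>, and in both exactly when it lies in
  \<open>u\<close>: inclusion-exclusion. By \<open>occurrences_Cons\<close> only position 0 needs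
  attention, and there \<open>r\<close> does not reach \<open>b\<close>.\<close>

lemma occurrences_overlap:
  assumes "length r \<le> Suc (length u)"
  shows "occurrences (a # u @ [b]) r + occurrences u r = occurrences (a # u) r + occurrences (u @ [b]) r"
proof -
  have "prefix r (a # u @ [b]) \<longleftrightarrow> prefix r (a # u)"
    using assms prefix_snoc[of r "a # u" b] by auto
  then show ?thesis by (simp add: occurrences_Cons)
qed

lemma allowed_sublist:
  assumes "allowed F w" "sublist v w"
  shows "allowed F v"
proof -
  obtain x i where x: "x \<in> shift_space F" "w = map x [i..<i + length w]"
    using assms(1) by (auto simp: allowed_def occurs_in_seq_def)
  obtain ps ss where w: "w = ps @ v @ ss" using assms(2) by (auto simp: sublist_def)
  have "v = map x [i + length ps..<i + length ps + length v]"
  proof (rule nth_equalityI)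
    fix j assume "j < length v"
    then have "v ! j = w ! (length ps + j)" "length ps + j < length w"
      by (auto simp: w nth_append)
    then have "v ! j = map x [i..<i + length w] ! (length ps + j)" using x(2) by simp
    then show "v ! j = map x [i + length ps..<i + length ps + length v] ! j"
      using \<open>j < length v\<close> \<open>length ps + j < length w\<close> by (simp add: add.assoc)
  qed simp
  then show ?thesis using x(1) by (auto simp: allowed_def occurs_in_seq_def)
qed

lemma sublist_take_drop: "sublist (take k (drop i w)) w"
  by (metis append_take_drop_id sublist_def)

text \<open>The general path count applies since the blocks, being subwords of an allowed word, are
  vertices.\<close>

lemma card_paths_along_blocks:
  assumes "w \<in> allowed_words F n" "1 \<le> p" "p \<le> n"
  shows "card (paths_along (matrix_graph (allowed_words F (p - 1)) A) (blocks p w)) =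
    (\<Prod>i<n - p + 1. A (take (p - 1) (drop i w)) (take (p - 1) (drop (Suc i) w)))"
proof -
  let ?f = "\<lambda>i. take (p - 1) (drop i w)"
  let ?Xs = "map ?f [1..<n - p + 2]"
  have n: "length w = n" "allowed F w" using assms(1) by (auto simp: allowed_words_def)
  have b: "blocks p w = ?f 0 # ?Xs"
    by (simp add: blocks_def n(1) upt_conv_Cons)
  have "?f i \<in> allowed_words F (p - 1)" if "i < n - p + 2" for i
    using that assms n allowed_sublist[OF n(2) sublist_take_drop]
    by (auto simp: allowed_words_def)
  from this this[of 0] have "set (?f 0 # ?Xs) \<subseteq> allowed_words F (p - 1)" by auto
  from card_paths_along_matrix_graph[OF this, of A]
  have "card (paths_along (matrix_graph (allowed_words F (p - 1)) A) (blocks p w)) =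
    (\<Prod>i<n - p + 1. A (blocks p w ! i) (blocks p w ! Suc i))"
    unfolding b by (simp del: upt_Suc)
  also have "\<dots> = (\<Prod>i<n - p + 1. A (?f i) (?f (Suc i)))"
    by (rule prod.cong) (auto simp: blocks_def n(1) simp del: upt_Suc)
  finally show ?thesis .
qed

text \<open>Identifies the edges met along \<open>w\<close> with its windows of length
  \<open>p\<close>. The bound on \<open>p\<close> keeps the blocks nonempty, as \<open>star\<close>
  requires.\<close>

lemma star_consecutive_blocks:
  assumes "2 \<le> p" "i + p \<le> length w"
  shows "star (take (p - 1) (drop i w)) (take (p - 1) (drop (Suc i) w)) = Some (take p (drop i w))"
proof -
  obtain q where p: "p = Suc (Suc q)" using assms(1) by (metis add_2_eq_Suc le_Suc_ex)
  define v where "v = drop i w"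
  have v: "Suc (Suc q) \<le> length v" using assms(2) by (simp add: v_def p)
  have "tl (take (Suc q) v) = butlast (take (Suc q) (tl v))"
    using v by (cases v) (auto simp: butlast_take)
  moreover have "take (Suc q) v @ [last (take (Suc q) (tl v))] = take (Suc (Suc q)) v"
    using v by (simp add: take_Suc_conv_app_nth nth_tl)
  ultimately show ?thesis
    using v by (auto simp: star_def p v_def[symmetric] drop_Suc tl_drop[symmetric])
qed

text \<open>Regroups the product by position: a window of length \<open>p\<close> matches at most
  one word of \<open>R\<close>. For \<open>w\<close> shorter than \<open>p\<close> the truncated
  subtraction leaves no window, and both sides are 1.\<close>

lemma prod_occurrences_eq_prod_windows:
  fixes m :: "'a list \<Rightarrow> nat"
  assumes "finite R" "\<forall>r\<in>R. length r = p" "0 < p"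
  shows "(\<Prod>r\<in>R. m r ^ occurrences w r) =
    (\<Prod>i<Suc (length w) - p. if take p (drop i w) \<in> R then m (take p (drop i w)) else 1)"
proof (induction w)
  case Nil
  then show ?case using assms by (simp add: occurrences_eq_0)
next
  case (Cons a w)
  show ?case
  proof (cases "p \<le> Suc (length w)")
    case False
    then show ?thesis using assms(2) by (simp add: occurrences_eq_0)
  next
    case True
    let ?v = "take p (a # w)"
    have pre: "prefix r (a # w) \<longleftrightarrow> r = ?v" if "r \<in> R" for r
      using that assms(2) True
      by (metis append_eq_conv_conj prefix_def take_is_prefix)
    have "(\<Prod>r\<in>R. m r ^ occurrences (a # w) r) =
        (\<Prod>r\<in>R. (if r = ?v then m r else 1) * m r ^ occurrences w r)"
      by (rule prod.cong) (auto simp: occurrences_Cons pre)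
    \<comment> \<open>Only the factor at \<open>r = ?v\<close> can differ from 1.\<close>
    also have "\<dots> = (if ?v \<in> R then m ?v else 1) * (\<Prod>r\<in>R. m r ^ occurrences w r)"
      using assms(1) by (simp add: prod.distrib)
    also have "\<dots> = (\<Prod>i<Suc (Suc (length w) - p).
        if take p (drop i (a # w)) \<in> R then m (take p (drop i (a # w))) else 1)"
      unfolding Cons.IH prod.lessThan_Suc_shift by (simp cong: if_cong)
    finally show ?thesis using True by (simp add: Suc_diff_le)
  qed
qed

lemma edge_shift_language_if_lengths_eq:
  assumes "finite R" "\<forall>r\<in>R. length r = p" "2 \<le> p"
  shows "edge_shift_language F p (Lambda F R m)"
proof -
  \<comment> \<open>The zeros give the required support condition; \<open>allowed F Z\<close> is
    tested because two allowed blocks may overlap to a word that is not allowed.\<close>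
  define A where "A X Y = (case star X Y of None \<Rightarrow> 0
    | Some Z \<Rightarrow> if allowed F Z then if Z \<in> R then m Z else 1 else 0)" for X Y
  have "A X Y = 0" if "X \<in> allowed_words F (p - 1)"
    "\<not> (\<exists>Z. star X Y = Some Z \<and> Z \<in> allowed_words F p)" for X Y
    using that assms(3) by (auto simp: A_def star_def allowed_words_def)
  moreover have "count (Lambda F R m n) w =
      card (paths_along (matrix_graph (allowed_words F (p - 1)) A) (blocks p w))"
    if "p \<le> n" and w: "w \<in> allowed_words F n" for n w
  proof -
    have n: "length w = n" "allowed F w" using w by (auto simp: allowed_words_def)
    have "count (Lambda F R m n) w = (\<Prod>r\<in>R. m r ^ occurrences w r)"
      using n(2) by (simp add: count_Lambda[OF w] word_mult_def)
    also have "\<dots> = (\<Prod>i<n - p + 1. if take p (drop i w) \<in> R then m (take p (drop i w)) else 1)"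
      using prod_occurrences_eq_prod_windows[OF assms(1,2), of m w] assms(3) n(1) \<open>p \<le> n\<close>
      by (simp add: Suc_diff_le)
    \<comment> \<open>Windows of an allowed word are allowed, so the zero branches of
      \<open>A\<close> are never taken.\<close>
    also have "\<dots> = (\<Prod>i<n - p + 1. A (take (p - 1) (drop i w)) (take (p - 1) (drop (Suc i) w)))"
    proof (rule prod.cong)
      fix i assume "i \<in> {..<n - p + 1}"
      then have "i + p \<le> length w" using n \<open>p \<le> n\<close> by auto
      then show "(if take p (drop i w) \<in> R then m (take p (drop i w)) else 1) =
          A (take (p - 1) (drop i w)) (take (p - 1) (drop (Suc i) w))"
        using allowed_sublist[OF n(2) sublist_take_drop]
        by (simp only: A_def star_consecutive_blocks[OF assms(3)] option.case if_True)
    qed simp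
    finally show ?thesis
      using card_paths_along_blocks[OF w _ \<open>p \<le> n\<close>] assms(3) by simp
  qed
  ultimately show ?thesis unfolding edge_shift_language_def by blast
qed

lemma edge_shift_language_word_mult_eq_1:
  assumes "edge_shift_language F (Suc (length u)) (Lambda F R m)"
    and m: "\<forall>r\<in>R. length r \<le> Suc (length u) \<and> 0 < m r"
    and aub: "allowed F (a # u @ [b])"
  shows "word_mult F R m u = 1"
proof -
  let ?p = "Suc (length u)"
  obtain A where A: "\<And>n w. ?p \<le> n \<Longrightarrow> w \<in> allowed_words F n \<Longrightarrow> count (Lambda F R m n) w =
      card (paths_along (matrix_graph (allowed_words F (?p - 1)) A) (blocks ?p w))"
    using assms(1) unfolding edge_shift_language_def by blast
  have mult: "word_mult F R m w = (\<Prod>i<length w - ?p + 1.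
      A (take (?p - 1) (drop i w)) (take (?p - 1) (drop (Suc i) w)))"
    if "allowed F w" "?p \<le> length w" for w
  proof -
    have w: "w \<in> allowed_words F (length w)" using that by (simp add: allowed_words_def)
    show ?thesis
      using A[OF that(2) w] card_paths_along_blocks[OF w _ that(2)] count_Lambda[OF w, of R m]
      by simp
  qed
  have au: "allowed F (a # u)"
    using aub by (rule allowed_sublist) (auto intro!: prefix_imp_sublist)
  have ub: "allowed F (u @ [b])"
    using aub by (rule allowed_sublist) (auto intro!: suffix_imp_sublist suffix_ConsI)
  have u: "allowed F u"
    using au by (rule allowed_sublist) (auto intro!: suffix_imp_sublist suffix_ConsI)
  \<comment> \<open>With \<open>p = |u| + 1\<close>, the words \<open>au\<close> and
    \<open>ub\<close> are single edges into and out of the vertex \<open>u\<close>, and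
    \<open>aub\<close> is the path made of these two edges.\<close>
  have edge: "word_mult F R m (a # u @ [b]) = word_mult F R m (a # u) * word_mult F R m (u @ [b])"
    using mult[OF aub] mult[OF au] mult[OF ub] by (simp add: lessThan_Suc numeral_2_eq_2 take_Cons' mult.commute)
  \<comment> \<open>All four words are allowed, so each multiplicity is a genuine product and the
    exponents of each \<open>m r\<close> can be compared.\<close>
  have "word_mult F R m (a # u @ [b]) * word_mult F R m u =
      word_mult F R m (a # u) * word_mult F R m (u @ [b])"
    using m aub au ub u occurrences_overlap[of _ u a b]
    by (simp add: word_mult_def prod.distrib[symmetric] power_add[symmetric])
  \<comment> \<open>Positivity permits cancelling \<open>m(aub)\<close> from
    \<open>m(aub) m(u) = m(aub)\<close>.\<close>
  moreover have "0 < word_mult F R m (a # u @ [b])"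
    using m aub by (auto simp: word_mult_def intro!: prod_pos)
  ultimately show ?thesis using edge by simp
qed

text \<open>Irreducibility puts some symbol \<open>c\<close> before \<open>r\<close>, so
  \<open>r\<close> does not start at position 0 of the sequence \<open>x\<close> found; reading
  further along \<open>x\<close> supplies the letters to the right.\<close>

lemma irreducible_extension:
  assumes "irreducible_shift F" "\<forall>a. allowed F [a]" "allowed F r" "length r \<le> k"
  obtains a u b where "allowed F (a # u @ [b])" "length u = k" "take (length r) u = r"
proof -
  fix c :: 'a
  obtain w where "allowed F ([c] @ w @ r)"
    using assms(1-3) unfolding irreducible_shift_def by blast
  then obtain x i where x: "x \<in> shift_space F"
      "[c] @ w @ r = map x [i..<i + length ([c] @ w @ r)]"
    by (auto simp: allowed_def occurs_in_seq_def)
  \<comment> \<open>\<open>x j\<close> is the letter just before \<open>r\<close>, which starts at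
    \<open>Suc j\<close>; it serves as \<open>a\<close>.\<close>
  define j where "j = i + length w"
  let ?u = "map x [Suc j..<Suc j + k]"
  have "r = drop (Suc (length w)) ([c] @ w @ r)" by simp
  also have "\<dots> = map x [Suc j..<Suc j + length r]"
    by (subst x(2)) (simp add: drop_map j_def add_ac del: upt_Suc)
  finally have r: "r = map x [Suc j..<Suc j + length r]" .
  have "x j # ?u @ [x (Suc j + k)] = map x [j..<j + (k + 2)]"
    using upt_conv_Cons[of j "j + (k + 2)"] upt_Suc_append[of "Suc j" "Suc j + k"]
    by (simp del: upt_Suc)
  then have "allowed F (x j # ?u @ [x (Suc j + k)])"
    using x(1) unfolding allowed_def occurs_in_seq_def
    by (metis length_map length_upt add_diff_cancel_left')
  moreover have "take (length r) ?u = r"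
    using assms(4) by (subst (2) r) (simp add: take_map del: upt_Suc)
  ultimately show ?thesis using that[of "x j" ?u "x (Suc j + k)"] by simp
qed

theorem theorem3p9:
  fixes F R :: "'a::finite list set" and m :: "'a list \<Rightarrow> nat" and p :: nat
  assumes "forbidden_collection F"
    and "\<forall>a. allowed F [a]"
    and "irreducible_shift F"
    and "repeated_collection F R m"
    and "F \<union> R \<noteq> {}"
    and "p = Max (length ` (F \<union> R))"
    and "p \<ge> 2"
  shows "edge_shift_language F p (Lambda F R m) \<longleftrightarrow> (\<forall>r\<in>R. length r = p)"
proof
  have R: "finite R" "\<forall>r\<in>R. allowed F r \<and> 2 \<le> m r"
    using assms(4) by (auto simp: repeated_collection_def)
  {
    assume "\<forall>r\<in>R. length r = p"
    then show "edge_shift_language F p (Lambda F R m)"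
      using edge_shift_language_if_lengths_eq R(1) assms(7) by blast
  }
  assume edge: "edge_shift_language F p (Lambda F R m)"
  have le: "length r \<le> p" if "r \<in> R" for r
    using that R(1) assms(1) unfolding assms(6) forbidden_collection_def by (intro Max_ge) auto
  show "\<forall>r\<in>R. length r = p"
  proof (rule ccontr)
    assume "\<not> (\<forall>r\<in>R. length r = p)"
    then obtain r where r: "r \<in> R" "length r \<le> p - 1" using le by fastforce
    obtain a u b where u: "allowed F (a # u @ [b])" "length u = p - 1" "take (length r) u = r"
      using irreducible_extension[OF assms(3,2) _ r(2)] R(2) r(1) by blast
    have "Suc (length u) = p" using u(2) assms(7) by simp
    then have 1: "word_mult F R m u = 1"
      using edge_shift_language_word_mult_eq_1[OF _ _ u(1)] edge le R(2) by fastforce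
    then have "(\<Prod>r\<in>R. m r ^ occurrences u r) = 1"
      by (simp add: word_mult_def split: if_splits)
    \<comment> \<open>A product of natural numbers is 1 only if every factor is 1.\<close>
    then have "\<forall>r\<in>R. m r ^ occurrences u r = 1"
      by (simp only: prod_eq_1_iff[OF R(1)])
    then have "m r ^ occurrences u r = 1"
      using r(1) by blast
    \<comment> \<open>\<open>r\<close> is a prefix of \<open>u\<close>; since \<open>m r\<close> is
      at least 2, its power then exceeds 1.\<close>
    moreover have "0 < occurrences u r"
      using occurrences_take_pos[of r "length u" u] u r by simp
    ultimately show False using R(2) r(1) by auto
  qed
qed

end
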